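(* Let $H$ be a graph and $v$ a non-isolated vertex of $H$. Then $\mathrm{Tr}(H,v)$ is a $\mathrm{W}_2$ graph if and only if $H$ is a $\mathrm{W}_2$ graph.
   Context: All graphs are finite, simple and undirected. A graph $G$ is a $\mathrm{W}_2$ graph if it has at least two vertices and every pair of disjoint independent sets of $G$ is contained in two disjoint maximum independent sets; that is, for all disjoint independent sets $A,B$ of $G$ there are disjoint independent sets $A'\supseteq A$ and $B'\supseteq B$ with $|A'|=|B'|=\alpha(G)$, where $\alpha(G)$ is the maximum size of an independent set of $G$. Trung's construction: for a graph $H$ and a non-isolated vertex $v$ of $H$, the graph $\mathrm{Tr}(H,v)$ is obtained from $H$ by adding three new vertices $a,b,c$ and the following edges: $c$ is joined to $b$ and to every neighbor of $v$ in $H$; $b$ is joined to $a$; and $a$ is joined to $v$. *)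

theory Defs
  imports "Graph_Theory.Pair_Digraph"
begin

text \<open>
  Finite simple undirected graphs are the library's \<open>pair_graph\<close>: finite, loop-free digraphs on
  pairs whose arc relation is symmetric, an undirected edge \<open>uv\<close> being the two arcs
  \<open>(u, v)\<close> and \<open>(v, u)\<close>.
\<close>

definition nbrs :: "'a pair_pre_digraph \<Rightarrow> 'a \<Rightarrow> 'a set" where
  "nbrs G v = {u. (v, u) \<in> parcs G}"

definition indep_set :: "'a pair_pre_digraph \<Rightarrow> 'a set \<Rightarrow> bool" where
  "indep_set G S \<longleftrightarrow> S \<subseteq> pverts G \<and> (\<forall>x\<in>S. \<forall>y\<in>S. (x, y) \<notin> parcs G)"

definition indep_num :: "'a pair_pre_digraph \<Rightarrow> nat" where
  "indep_num G = Max {card S | S. indep_set G S}"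

definition max_indep_set :: "'a pair_pre_digraph \<Rightarrow> 'a set \<Rightarrow> bool" where
  "max_indep_set G S \<longleftrightarrow> indep_set G S \<and> card S = indep_num G"

definition W2_graph :: "'a pair_pre_digraph \<Rightarrow> bool" where
  "W2_graph G \<longleftrightarrow> pair_graph G \<and> 2 \<le> card (pverts G) \<and>
     (\<forall>A B. indep_set G A \<and> indep_set G B \<and> A \<inter> B = {} \<longrightarrow>
        (\<exists>A' B'. max_indep_set G A' \<and> max_indep_set G B' \<and>
           A \<subseteq> A' \<and> B \<subseteq> B' \<and> A' \<inter> B' = {}))"

text \<open>
  The vertices of \<open>Tr(H, v)\<close>: \<open>Old x\<close> is the vertex \<open>x\<close> of \<open>H\<close>, and the three remaining
  constructors are the new vertices \<open>a, b, c\<close>. Extending the type makes them fresh for every \<open>H\<close>.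
\<close>

datatype 'a tr_vertex = Old 'a | New_a | New_b | New_c

definition sym_arcs :: "'a rel \<Rightarrow> 'a rel" where
  "sym_arcs R = R \<union> R\<inverse>"

definition Tr :: "'a pair_pre_digraph \<Rightarrow> 'a \<Rightarrow> 'a tr_vertex pair_pre_digraph" where
  "Tr H v =
     \<lparr> pverts = Old ` pverts H \<union> {New_a, New_b, New_c},
       parcs = {(Old x, Old y) | x y. (x, y) \<in> parcs H} \<union>
         sym_arcs ({(New_c, New_b), (New_b, New_a), (New_a, Old v)} \<union>
                   {(New_c, Old u) | u. u \<in> nbrs H v}) \<rparr>"

lemma pair_graph_Tr:
  assumes "pair_graph H" "v \<in> pverts H"
  shows "pair_graph (Tr H v)"
proof -
  have arcs: "x \<in> pverts H \<and> y \<in> pverts H \<and> x \<noteq> y" if "(x, y) \<in> parcs H" for x y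
  proof -
    interpret pair_graph H by fact
    show ?thesis
      using in_arcsD1[OF that] in_arcsD2[OF that] no_loops'[OF that] by (intro conjI)
  qed
  have finV: "finite (pverts H)" and symH: "sym (parcs H)"
  proof -
    interpret pair_graph H by fact
    show "finite (pverts H)" by (fact pair_finite_verts)
    show "sym (parcs H)" using pair_sym_arcs by (simp add: symmetric_def)
  qed
  define R :: "'a tr_vertex rel" where "R = {(New_c, New_b), (New_b, New_a), (New_a, Old v)} \<union>
                      {(New_c, Old u) | u. u \<in> nbrs H v}"
  define P :: "'a tr_vertex rel" where "P = {(Old x, Old y) | x y. (x, y) \<in> parcs H}"
  define V :: "'a tr_vertex set" where "V = Old ` pverts H \<union> {New_a, New_b, New_c}"
  have sel: "pverts (Tr H v) = V" "parcs (Tr H v) = P \<union> (R \<union> R\<inverse>)"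
    unfolding Tr_def sym_arcs_def R_def P_def V_def by simp_all
  have nV: "New_a \<in> V" "New_b \<in> V" "New_c \<in> V" and oV: "Old x \<in> V" if "x \<in> pverts H" for x
    using that unfolding V_def by blast+
  have "e \<in> V \<times> V" if "e \<in> R" for e
  proof -
    from that consider "e = (New_c, New_b)" | "e = (New_b, New_a)" | "e = (New_a, Old v)"
      | u where "e = (New_c, Old u)" "(v, u) \<in> parcs H"
      unfolding R_def nbrs_def by blast
    then show ?thesis
      using nV[OF assms(2)] oV[OF assms(2)] oV arcs by cases blast+
  qed
  moreover have "e \<in> V \<times> V" if "e \<in> P" for e
  proof -
    from that obtain x y where "e = (Old x, Old y)" "(x, y) \<in> parcs H"
      unfolding P_def by blast
    then show ?thesis using oV arcs by blast
  qed
  ultimately have "R \<subseteq> V \<times> V" "P \<subseteq> V \<times> V"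
    by blast+
  then have sub: "P \<union> (R \<union> R\<inverse>) \<subseteq> V \<times> V"
    by blast
  have fin: "finite V"
    by (simp add: V_def finV)
  have fin_arcs: "finite (P \<union> (R \<union> R\<inverse>))"
    using sub fin by (meson finite_SigmaI finite_subset)
  have "sym P"
    using symH unfolding P_def sym_def by blast
  then have sym: "sym (P \<union> (R \<union> R\<inverse>))"
    unfolding sym_def by blast
  have "(x, x) \<notin> R" "(x, x) \<notin> P" for x
    using arcs unfolding R_def P_def by blast+
  then have irr: "fst e \<noteq> snd e" if "e \<in> P \<union> (R \<union> R\<inverse>)" for e
    using that by (cases e) auto
  show ?thesis
  proof unfold_locales
    show "fst e \<in> pverts (Tr H v)" "snd e \<in> pverts (Tr H v)" if "e \<in> parcs (Tr H v)" for e
      using subsetD[OF sub that[unfolded sel]] unfolding sel by (simp_all add: mem_Times_iff)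
    show "fst e \<noteq> snd e" if "e \<in> parcs (Tr H v)" for e
      using that irr unfolding sel by blast
    show "finite (pverts (Tr H v))" "finite (parcs (Tr H v))"
      unfolding sel by (fact fin, fact fin_arcs)
    show "symmetric (with_proj (Tr H v))"
      using sym unfolding symmetric_def by (simp add: sel)
  qed
qed

end

theory Submission
  imports Defs
begin

text \<open>
  The property \<open>W\<^sub>2\<close> is governed by single vertices: a graph with at least two vertices is
  \<open>W\<^sub>2\<close> as soon as every independent set \<open>S\<close> and every vertex \<open>x\<close> outside \<open>S\<close> admit a
  maximum independent set that contains \<open>S\<close> and avoids \<open>x\<close> (\<open>avoid_set_if_avoid_vertex\<close> and
  \<open>W2_graphI\<close>). The reason is an exchange: a maximum set that meets a second independent
  set \<open>B\<close> in \<open>x\<close> can trade \<open>x\<close> for a neighbour of \<open>x\<close>, and such a neighbour is never in \<open>B\<close>.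

  In \<open>Tr(H, v)\<close> an independent set contains at most one new vertex, or else exactly \<open>a\<close> and \<open>c\<close>;
  in the latter case its old part misses \<open>v\<close> and all neighbours of \<open>v\<close> and leaves room for \<open>v\<close>.
  Therefore \<open>\<alpha>(Tr(H, v)) = \<alpha>(H) + 1\<close> (\<open>indep_num_Tr\<close>).

  If \<open>Tr(H, v)\<close> is \<open>W\<^sub>2\<close>, then adding \<open>b\<close> to an independent set of \<open>H\<close>, extending in
  \<open>Tr(H, v)\<close> and deleting \<open>b\<close> again extends the set in \<open>H\<close>, because \<open>b\<close> excludes both \<open>a\<close> and
  \<open>c\<close>. If \<open>H\<close> is \<open>W\<^sub>2\<close>, then a maximum independent set \<open>T\<close> of \<open>H\<close> gives the maximum
  independent sets \<open>T + b\<close>; \<open>T + a\<close> when \<open>v \<notin> T\<close>; and \<open>T + c\<close> and \<open>T - v + a + c\<close> when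
  \<open>v \<in> T\<close>. These are numerous enough to contain any prescribed independent set and to avoid any
  prescribed vertex outside it.
\<close>

section \<open>Independent sets and the one-vertex form of the property\<close>

lemma finite_pverts:
  assumes "pair_graph G"
  shows "finite (pverts G)"
proof -
  interpret pair_graph G by fact
  show ?thesis by (fact pair_finite_verts)
qed

lemma parcs_sym:
  assumes "pair_graph G" "(x, y) \<in> parcs G"
  shows "(y, x) \<in> parcs G"
proof -
  interpret pair_graph G by fact
  show ?thesis using pair_sym_arcs assms(2) by (simp add: symmetric_def sym_def)
qed

lemma parcs_verts:
  assumes "pair_graph G" "(x, y) \<in> parcs G"
  shows "x \<in> pverts G" "y \<in> pverts G" "x \<noteq> y"
proof -
  interpret pair_graph G by fact
  show "x \<in> pverts G" "y \<in> pverts G" "x \<noteq> y"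
    using in_arcsD1[OF assms(2)] in_arcsD2[OF assms(2)] no_loops'[OF assms(2)] by blast+
qed

lemma indep_set_subset: "indep_set G S \<Longrightarrow> R \<subseteq> S \<Longrightarrow> indep_set G R"
  unfolding indep_set_def by blast

lemma indep_set_empty: "indep_set G {}"
  unfolding indep_set_def by blast

lemma indep_set_finite: "pair_graph G \<Longrightarrow> indep_set G S \<Longrightarrow> finite S"
  unfolding indep_set_def using finite_pverts finite_subset by blast

lemma indep_set_insert:
  assumes "pair_graph G" "indep_set G S" "x \<in> pverts G" "S \<inter> nbrs G x = {}"
  shows "indep_set G (insert x S)"
  using assms parcs_sym[OF assms(1)] parcs_verts(3)[OF assms(1)]
  unfolding indep_set_def nbrs_def by blast

lemma indep_set_if_subset_singleton:
  assumes "pair_graph G" "S \<subseteq> pverts G" "S \<subseteq> {x}"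
  shows "indep_set G S"
  using assms parcs_verts(3)[OF assms(1)] unfolding indep_set_def by blast

lemma finite_indep_cards:
  assumes "pair_graph G"
  shows "finite {card S | S. indep_set G S}"
proof -
  have "{card S | S. indep_set G S} \<subseteq> card ` Pow (pverts G)"
    unfolding indep_set_def by blast
  then show ?thesis
    using finite_pverts[OF assms] by (meson finite_Pow_iff finite_imageI finite_subset)
qed

lemma card_le_indep_num:
  assumes "pair_graph G" "indep_set G S"
  shows "card S \<le> indep_num G"
  unfolding indep_num_def using finite_indep_cards[OF assms(1)] assms(2) by (auto intro: Max_ge)

lemma ex_max_indep_set:
  assumes "pair_graph G"
  shows "\<exists>S. max_indep_set G S"
proof -
  have "indep_num G \<in> {card S | S. indep_set G S}"
    unfolding indep_num_def
    by (rule Max_in[OF finite_indep_cards[OF assms]]) (use indep_set_empty in blast)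
  then show ?thesis unfolding max_indep_set_def by auto
qed

text \<open>
  Among the maximum sets containing \<open>A\<close>, one that meets \<open>B\<close> in as few vertices as possible
  does not meet \<open>B\<close> at all. Otherwise it contains some \<open>x \<in> B\<close>; removing \<open>x\<close> and extending again
  without \<open>x\<close> brings in a single vertex \<open>y\<close>. By maximality \<open>y\<close> is a neighbour of \<open>x\<close>, hence is
  not in the independent set \<open>B\<close>, and the intersection with \<open>B\<close> has shrunk.
\<close>

lemma avoid_set_if_avoid_vertex:
  assumes G: "pair_graph G"
    and avoid: "\<And>S x. indep_set G S \<Longrightarrow> x \<notin> S \<Longrightarrow> \<exists>S'. max_indep_set G S' \<and> S \<subseteq> S' \<and> x \<notin> S'"
    and A: "indep_set G A" and B: "indep_set G B" and AB: "A \<inter> B = {}"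
  shows "\<exists>A'. max_indep_set G A' \<and> A \<subseteq> A' \<and> A' \<inter> B = {}"
proof -
  have shrink: "\<exists>A'. max_indep_set G A' \<and> A \<subseteq> A' \<and> A' \<inter> B = {}"
    if "max_indep_set G M" "A \<subseteq> M" for M
    using that
  proof (induction "card (M \<inter> B)" arbitrary: M rule: less_induct)
    case less
    show ?case
    proof (cases "M \<inter> B = {}")
      case True
      then show ?thesis using less.prems by blast
    next
      case False
      then obtain x where x: "x \<in> M" "x \<in> B" by blast
      have M: "indep_set G M" "card M = indep_num G" "finite M"
        using less.prems(1) indep_set_finite[OF G] unfolding max_indep_set_def by blast+
      have "indep_set G (M - {x})" using M(1) indep_set_subset by blast
      then obtain M' where M': "max_indep_set G M'" "M - {x} \<subseteq> M'" "x \<notin> M'"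
        using avoid[of "M - {x}" x] by blast
      have M'': "indep_set G M'" "card M' = indep_num G" "finite M'"
        using M'(1) indep_set_finite[OF G] unfolding max_indep_set_def by blast+
      have "card (M' - (M - {x})) = 1"
        using M M'' M'(2) x(1) card_gt_0_iff[of M] by (auto simp: card_Diff_subset)
      then obtain y where y: "M' - (M - {x}) = {y}" by (auto simp: card_Suc_eq)
      have yM: "y \<notin> M" "y \<in> M'" using y M'(3) by blast+
      have "y \<notin> B"
      proof
        assume "y \<in> B"
        have "(y, z) \<notin> parcs G" if "z \<in> M" for z
          using that M''(1) B x(2) \<open>y \<in> B\<close> yM(2) M'(2) unfolding indep_set_def
          by (cases "z = x") auto
        moreover have "y \<in> pverts G" using \<open>y \<in> B\<close> B unfolding indep_set_def by blast
        ultimately have "indep_set G (insert y M)"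
          using indep_set_insert[OF G M(1)] unfolding nbrs_def by blast
        then show False
          using card_le_indep_num[OF G, of "insert y M"] M yM(1) by simp
      qed
      moreover have "M' \<subseteq> insert y M" using y by blast
      ultimately have "M' \<inter> B \<subset> M \<inter> B" using x M'(3) by blast
      then have "card (M' \<inter> B) < card (M \<inter> B)" using M(3) by (simp add: psubset_card_mono)
      moreover have "A \<subseteq> M'" using less.prems(2) x(2) AB M'(2) by blast
      ultimately show ?thesis using less.hyps M'(1) by blast
    qed
  qed
  show ?thesis
  proof (cases "B = {}")
    case True
    \<comment> \<open>No vertex of \<open>B\<close> is available here; if nothing lies outside \<open>A\<close>, then \<open>A\<close> is already maximum.\<close>
    show ?thesis
    proof (cases "A = UNIV")
      case True
      obtain M where "max_indep_set G M" using ex_max_indep_set[OF G] by blast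
      moreover have "card M \<le> card A"
        using True indep_set_finite[OF G A] by (simp add: card_mono)
      ultimately have "max_indep_set G A"
        using A card_le_indep_num[OF G A] unfolding max_indep_set_def by simp
      then show ?thesis using shrink by blast
    next
      case False
      then show ?thesis using avoid[OF A] shrink by blast
    qed
  next
    case False
    then show ?thesis using avoid[OF A] AB shrink by blast
  qed
qed

text \<open>
  Two uses of avoidance suffice: extend \<open>A\<close> to a maximum set that avoids \<open>B\<close>, then extend \<open>B\<close>
  to one that avoids the extension of \<open>A\<close>.
\<close>

lemma W2_graphI:
  assumes G: "pair_graph G" and "2 \<le> card (pverts G)"
    and "\<And>S x. indep_set G S \<Longrightarrow> x \<notin> S \<Longrightarrow> \<exists>S'. max_indep_set G S' \<and> S \<subseteq> S' \<and> x \<notin> S'"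
  shows "W2_graph G"
  unfolding W2_graph_def
proof (intro conjI allI impI assms(1,2))
  note avoid = avoid_set_if_avoid_vertex[OF G assms(3)]
  fix A B
  assume AB: "indep_set G A \<and> indep_set G B \<and> A \<inter> B = {}"
  obtain A' where A': "max_indep_set G A'" "A \<subseteq> A'" "A' \<inter> B = {}"
    using avoid[of A B] AB by blast
  have "indep_set G A'" using A'(1) unfolding max_indep_set_def by blast
  then obtain B' where "max_indep_set G B'" "B \<subseteq> B'" "B' \<inter> A' = {}"
    using avoid[of B A'] AB A'(3) by blast
  then show "\<exists>A' B'. max_indep_set G A' \<and> max_indep_set G B' \<and>
      A \<subseteq> A' \<and> B \<subseteq> B' \<and> A' \<inter> B' = {}"
    using A' by blast
qed

lemma W2_graph_avoid_set:
  assumes "W2_graph G" "indep_set G A" "indep_set G B" "A \<inter> B = {}"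
  obtains A' where "max_indep_set G A'" "A \<subseteq> A'" "A' \<inter> B = {}"
proof -
  obtain A' B' where "max_indep_set G A'" "A \<subseteq> A'" "B \<subseteq> B'" "A' \<inter> B' = {}"
    using assms unfolding W2_graph_def by meson
  then show thesis using that[of A'] by blast
qed

section \<open>Independent sets of Trung's construction\<close>

lemma parcs_Tr:
  "(Old x, Old y) \<in> parcs (Tr H v) \<longleftrightarrow> (x, y) \<in> parcs H"
  "(Old x, New_a) \<in> parcs (Tr H v) \<longleftrightarrow> x = v" "(New_a, Old x) \<in> parcs (Tr H v) \<longleftrightarrow> x = v"
  "(Old x, New_b) \<notin> parcs (Tr H v)" "(New_b, Old x) \<notin> parcs (Tr H v)"
  "(Old x, New_c) \<in> parcs (Tr H v) \<longleftrightarrow> x \<in> nbrs H v"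
  "(New_c, Old x) \<in> parcs (Tr H v) \<longleftrightarrow> x \<in> nbrs H v"
  "(New_a, New_b) \<in> parcs (Tr H v)" "(New_b, New_a) \<in> parcs (Tr H v)"
  "(New_b, New_c) \<in> parcs (Tr H v)" "(New_c, New_b) \<in> parcs (Tr H v)"
  "(New_a, New_c) \<notin> parcs (Tr H v)" "(New_c, New_a) \<notin> parcs (Tr H v)"
  "(New_a, New_a) \<notin> parcs (Tr H v)" "(New_b, New_b) \<notin> parcs (Tr H v)"
  "(New_c, New_c) \<notin> parcs (Tr H v)"
  by (simp_all add: Tr_def sym_arcs_def)

lemma indep_set_Tr_iff:
  "indep_set (Tr H v) S \<longleftrightarrow>
    indep_set H (Old -` S) \<and>
    (New_b \<in> S \<longrightarrow> New_a \<notin> S \<and> New_c \<notin> S) \<and>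
    (New_a \<in> S \<longrightarrow> Old v \<notin> S) \<and>
    (New_c \<in> S \<longrightarrow> Old -` S \<inter> nbrs H v = {})" (is "?L \<longleftrightarrow> ?R")
proof
  assume ?L
  then have verts: "S \<subseteq> pverts (Tr H v)"
    and arcs: "\<And>s t. s \<in> S \<Longrightarrow> t \<in> S \<Longrightarrow> (s, t) \<notin> parcs (Tr H v)"
    unfolding indep_set_def by blast+
  have "Old -` S \<subseteq> pverts H" using verts unfolding Tr_def by auto
  moreover have "(x, y) \<notin> parcs H" if "Old x \<in> S" "Old y \<in> S" for x y
    using arcs[OF that] by (simp add: parcs_Tr)
  ultimately have "indep_set H (Old -` S)" unfolding indep_set_def by blast
  moreover have "New_b \<in> S \<longrightarrow> New_a \<notin> S \<and> New_c \<notin> S" "New_a \<in> S \<longrightarrow> Old v \<notin> S"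
    using arcs[of New_b New_a] arcs[of New_b New_c] arcs[of New_a "Old v"]
    by (auto simp: parcs_Tr)
  moreover have "x \<notin> nbrs H v" if "New_c \<in> S" "Old x \<in> S" for x
    using arcs[OF that] by (simp add: parcs_Tr)
  ultimately show ?R by blast
next
  assume R: ?R
  have "s \<in> pverts (Tr H v)" if "s \<in> S" for s
    using that R unfolding indep_set_def Tr_def by (cases s) auto
  moreover have "(s, t) \<notin> parcs (Tr H v)" if st: "s \<in> S" "t \<in> S" for s t
  proof (cases s)
    case (Old x)
    then show ?thesis using st R unfolding indep_set_def by (cases t) (auto simp: parcs_Tr)
  next
    case New_a
    then show ?thesis using st R by (cases t) (auto simp: parcs_Tr)
  next
    case New_b
    then show ?thesis using st R by (cases t) (auto simp: parcs_Tr)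
  next
    case New_c
    then show ?thesis using st R by (cases t) (auto simp: parcs_Tr)
  qed
  ultimately show ?L unfolding indep_set_def by blast
qed

lemma split_old_new: "S = Old ` (Old -` S) \<union> (S \<inter> {New_a, New_b, New_c})"
proof -
  have "s \<in> Old ` (Old -` S) \<union> (S \<inter> {New_a, New_b, New_c})" if "s \<in> S" for s
    using that by (cases s) auto
  then show ?thesis by blast
qed

lemma card_split_old_new:
  assumes "finite (Old -` S)"
  shows "card S = card (Old -` S) + card (S \<inter> {New_a, New_b, New_c})"
proof -
  have "card S = card (Old ` (Old -` S) \<union> (S \<inter> {New_a, New_b, New_c}))"
    using split_old_new[of S] by simp
  also have "\<dots> = card (Old ` (Old -` S)) + card (S \<inter> {New_a, New_b, New_c})"
    using finite_imageI[OF assms] by (intro card_Un_disjoint) blast+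
  also have "card (Old ` (Old -` S)) = card (Old -` S)"
    by (intro card_image) (simp add: inj_on_def)
  finally show ?thesis .
qed

lemma vimage_Old_image [simp]: "Old -` Old ` T = T"
  by auto

text \<open>
  Only the pair \<open>a, c\<close> could push the size beyond \<open>\<alpha>(H) + 1\<close>. When both are present, \<open>c\<close>
  excludes the neighbours of \<open>v\<close> and \<open>a\<close> excludes \<open>v\<close>, so \<open>v\<close> can be added to the old part,
  which thus has at most \<open>\<alpha>(H) - 1\<close> vertices.
\<close>

lemma card_indep_set_Tr_le:
  assumes H: "pair_graph H" and v: "v \<in> pverts H" and S: "indep_set (Tr H v) S"
  shows "card S \<le> Suc (indep_num H)"
proof -
  let ?T = "Old -` S"
  note S' = S[unfolded indep_set_Tr_iff]
  have T: "indep_set H ?T" "finite ?T" using S' indep_set_finite[OF H] by blast+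
  note split = card_split_old_new[OF T(2)]
  show ?thesis
  proof (cases "New_a \<in> S \<and> New_c \<in> S")
    case True
    then have "indep_set H (insert v ?T)"
      using indep_set_insert[OF H T(1) v] S' by blast
    moreover have "v \<notin> ?T" using S' True by simp
    ultimately have "Suc (card ?T) \<le> indep_num H"
      using card_le_indep_num[OF H] T(2) by fastforce
    moreover have "S \<inter> {New_a, New_b, New_c} = {New_a, New_c}"
      using S' True by auto
    ultimately show ?thesis using split by simp
  next
    case False
    then have "S \<inter> {New_a, New_b, New_c} \<subseteq> {if New_a \<in> S then New_a else if New_b \<in> S then New_b else New_c}"
      using S' by auto
    then have "card (S \<inter> {New_a, New_b, New_c}) \<le> 1"
      by (metis card_mono finite.emptyI finite.insertI is_singletonI is_singleton_altdef)
    then show ?thesis using split card_le_indep_num[OF H T(1)] by simp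
  qed
qed

lemma card_indep_set_add_b:
  assumes H: "pair_graph H" and T: "indep_set H T"
  shows "indep_set (Tr H v) (insert New_b (Old ` T))" "card (insert New_b (Old ` T)) = Suc (card T)"
proof -
  show "indep_set (Tr H v) (insert New_b (Old ` T))"
    using T unfolding indep_set_Tr_iff by (auto simp: vimage_def image_iff)
  show "card (insert New_b (Old ` T)) = Suc (card T)"
    using indep_set_finite[OF H T] by (subst card_insert_disjoint) (auto simp: card_image inj_on_def)
qed

lemma indep_num_Tr:
  assumes H: "pair_graph H" and v: "v \<in> pverts H"
  shows "indep_num (Tr H v) = Suc (indep_num H)"
proof (rule antisym)
  note G = pair_graph_Tr[OF H v]
  show "indep_num (Tr H v) \<le> Suc (indep_num H)"
    using ex_max_indep_set[OF G] card_indep_set_Tr_le[OF H v] unfolding max_indep_set_def by metis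
  obtain T where T: "indep_set H T" "card T = indep_num H"
    using ex_max_indep_set[OF H] unfolding max_indep_set_def by blast
  show "Suc (indep_num H) \<le> indep_num (Tr H v)"
    using card_le_indep_num[OF G card_indep_set_add_b(1)[OF H T(1)]]
      card_indep_set_add_b(2)[OF H T(1)] T(2) by simp
qed

text \<open>
  The maximum independent sets of \<open>Tr(H, v)\<close> that come from one of \<open>H\<close>. In the last one the
  two new vertices compensate for the loss of \<open>v\<close>.
\<close>

lemma max_indep_set_Tr:
  assumes H: "pair_graph H" and v: "v \<in> pverts H" and T: "max_indep_set H T"
  shows "max_indep_set (Tr H v) (insert New_b (Old ` T))"
    and "v \<notin> T \<Longrightarrow> max_indep_set (Tr H v) (insert New_a (Old ` T))"
    and "v \<in> T \<Longrightarrow> max_indep_set (Tr H v) (insert New_c (Old ` T))"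
    and "v \<in> T \<Longrightarrow> max_indep_set (Tr H v) (insert New_a (insert New_c (Old ` (T - {v}))))"
proof -
  have T: "indep_set H T" "card T = indep_num H" "finite T"
    using T indep_set_finite[OF H] unfolding max_indep_set_def by blast+
  have card_Old: "card (Old ` R) = card R" for R :: "'a set"
    by (simp add: card_image inj_on_def)
  have vimages: "Old -` insert New_a R = Old -` R" "Old -` insert New_b R = Old -` R"
    "Old -` insert New_c R = Old -` R" for R :: "'a tr_vertex set"
    by auto
  note simps = max_indep_set_def indep_num_Tr[OF H v] indep_set_Tr_iff vimages
  show "max_indep_set (Tr H v) (insert New_b (Old ` T))"
    using card_indep_set_add_b[OF H T(1)] T(2) by (simp add: simps(1,2))
  show "max_indep_set (Tr H v) (insert New_a (Old ` T))" if "v \<notin> T"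
    unfolding simps using that T by (auto simp: card_insert_if card_Old)
  have nbrs: "T \<inter> nbrs H v = {}" if "v \<in> T"
    using that T(1) unfolding indep_set_def nbrs_def by blast
  show "max_indep_set (Tr H v) (insert New_c (Old ` T))" if "v \<in> T"
    unfolding simps using that T nbrs[OF that] by (auto simp: card_insert_if card_Old)
  show "max_indep_set (Tr H v) (insert New_a (insert New_c (Old ` (T - {v}))))" if "v \<in> T"
  proof -
    have "indep_set H (T - {v})" using T(1) indep_set_subset by blast
    moreover have "Suc (card (T - {v})) = card T"
      using that T(3) by (metis card_Suc_Diff1)
    ultimately show ?thesis
      unfolding simps using T nbrs[OF that] by (auto simp: card_insert_if card_Old)
  qed
qed

section \<open>Transfer of the property\<close>

text \<open>
  Since \<open>b\<close> is adjacent to \<open>a\<close> and \<open>c\<close>, a maximum independent set of \<open>Tr(H, v)\<close> that contains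
  \<open>b\<close> is \<open>b\<close> together with a maximum independent set of \<open>H\<close>. A neighbour of \<open>v\<close> provides
  the second vertex that the definition demands of \<open>H\<close>.
\<close>

lemma W2_graph_if_W2_graph_Tr:
  assumes H: "pair_graph H" and v: "v \<in> pverts H" and N: "nbrs H v \<noteq> {}"
    and W: "W2_graph (Tr H v)"
  shows "W2_graph H"
proof (rule W2_graphI[OF H])
  obtain u where "(v, u) \<in> parcs H" using N unfolding nbrs_def by blast
  then have "{v, u} \<subseteq> pverts H" "card {v, u} = 2" using parcs_verts[OF H] by auto
  then show "2 \<le> card (pverts H)" using card_mono[OF finite_pverts[OF H]] by metis
next
  note G = pair_graph_Tr[OF H v]
  fix S x
  assume S: "indep_set H S" and x: "x \<notin> S"
  \<comment> \<open>Intersecting with the vertex set makes the set to avoid independent even if \<open>x\<close> is not a vertex.\<close>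
  have "indep_set (Tr H v) ({Old x} \<inter> pverts (Tr H v))"
    using indep_set_if_subset_singleton[OF G] by blast
  then obtain M where M: "max_indep_set (Tr H v) M" "insert New_b (Old ` S) \<subseteq> M"
    "M \<inter> ({Old x} \<inter> pverts (Tr H v)) = {}"
    using W2_graph_avoid_set[OF W card_indep_set_add_b(1)[OF H S]] x by blast
  have Mi: "indep_set (Tr H v) M" "card M = Suc (indep_num H)"
    using M(1) indep_num_Tr[OF H v] unfolding max_indep_set_def by simp_all
  note M' = Mi(1)[unfolded indep_set_Tr_iff]
  have "M \<inter> {New_a, New_b, New_c} = {New_b}" using M' M(2) by auto
  then have "card (Old -` M) = indep_num H"
    using card_split_old_new[of M] indep_set_finite[OF H] M' Mi(2) by simp
  then have "max_indep_set H (Old -` M)" using M' unfolding max_indep_set_def by blast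
  moreover have "Old x \<notin> M" using M(3) Mi(1) unfolding indep_set_def by blast
  ultimately show "\<exists>S'. max_indep_set H S' \<and> S \<subseteq> S' \<and> x \<notin> S'"
    using M(2) by blast
qed

lemma W2_graph_Tr_if_W2_graph:
  assumes H: "pair_graph H" and v: "v \<in> pverts H" and W: "W2_graph H"
  shows "W2_graph (Tr H v)"
proof (rule W2_graphI[OF pair_graph_Tr[OF H v]])
  have "{New_a, New_b} \<subseteq> pverts (Tr H v)" "card {New_a, New_b} = 2" by (auto simp: Tr_def)
  then show "2 \<le> card (pverts (Tr H v))"
    using card_mono[OF finite_pverts[OF pair_graph_Tr[OF H v]]] by metis
next
  fix S x
  assume S: "indep_set (Tr H v) S" and x: "x \<notin> S"
  let ?goal = "\<exists>S'. max_indep_set (Tr H v) S' \<and> S \<subseteq> S' \<and> x \<notin> S'"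
  define T where "T = Old -` S"
  \<comment> \<open>The old vertices to avoid: at most one, and none if \<open>x\<close> is new.\<close>
  define X where "X = {u \<in> pverts H. Old u = x}"
  have S': "indep_set H T" "New_b \<in> S \<longrightarrow> New_a \<notin> S \<and> New_c \<notin> S"
    "New_a \<in> S \<longrightarrow> v \<notin> T" "New_c \<in> S \<longrightarrow> T \<inter> nbrs H v = {}"
    using S unfolding T_def indep_set_Tr_iff by auto
  have S_sub: "S \<subseteq> R" if "Old ` T \<subseteq> R" "S \<inter> {New_a, New_b, New_c} \<subseteq> R" for R
    using that unfolding T_def by (subst split_old_new) (rule Un_least)
  \<comment> \<open>The value \<open>inv Old x\<close> is meaningful only for an old \<open>x\<close>; for a new one \<open>X\<close> is empty.\<close>
  have X: "indep_set H X"
    by (rule indep_set_if_subset_singleton[OF H, where x = "inv Old x"])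
      (auto simp: X_def inj_def inv_f_f)
  have TX: "T \<inter> X = {}" using x by (auto simp: T_def X_def)
  have avoid: "Old u \<noteq> x" if "max_indep_set H R" "R \<inter> X = {}" "u \<in> R" for R u
    using that unfolding X_def max_indep_set_def indep_set_def by blast
  note ext = W2_graph_avoid_set[OF W]
  note max_Tr = max_indep_set_Tr[OF H v]
  show ?goal
  proof (cases "New_c \<in> S")
    case c: True
    then have xc: "x \<noteq> New_c" and nb: "New_b \<notin> S" using x S'(2) by blast+
    have vT: "indep_set H (insert v T)"
      using indep_set_insert[OF H S'(1) v] S'(4) c by blast
    show ?thesis
    proof (cases "x = Old v")
      case True
      then have "v \<notin> T" using x unfolding T_def by blast
      obtain R where R: "max_indep_set H R" "insert v T \<subseteq> R"
        using ext[OF vT indep_set_empty] by blast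
      have "S \<subseteq> insert New_a (insert New_c (Old ` (R - {v})))"
        using R(2) \<open>v \<notin> T\<close> nb by (intro S_sub) auto
      then show ?thesis using max_Tr(4)[OF R(1)] R(2) True by blast
    next
      case xv: False
      then have "insert v T \<inter> X = {}" using TX by (auto simp: X_def)
      then obtain R where R: "max_indep_set H R" "insert v T \<subseteq> R" "R \<inter> X = {}"
        using ext[OF vT X] by blast
      show ?thesis
      proof (cases "New_a \<in> S")
        case True
        then have "S \<subseteq> insert New_a (insert New_c (Old ` (R - {v})))"
          using R(2) S'(3) nb by (intro S_sub) auto
        moreover have "x \<notin> insert New_a (insert New_c (Old ` (R - {v})))"
          using avoid[OF R(1,3)] x xc True by auto
        ultimately show ?thesis using max_Tr(4)[OF R(1)] R(2) by blast
      next
        case False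
        then have "S \<subseteq> insert New_c (Old ` R)"
          using R(2) nb by (intro S_sub) auto
        moreover have "x \<notin> insert New_c (Old ` R)"
          using avoid[OF R(1,3)] xc by auto
        ultimately show ?thesis using max_Tr(3)[OF R(1)] R(2) by blast
      qed
    qed
  next
    case nc: False
    show ?thesis
    proof (cases "New_a \<in> S")
      case na: False
      obtain R where R: "max_indep_set H R" "T \<subseteq> R" "R \<inter> X = {}"
        using ext[OF S'(1) X TX] by blast
      have xR: "x \<notin> Old ` R" using avoid[OF R(1,3)] by auto
      show ?thesis
      proof (cases "x = New_b")
        case False
        have "S \<subseteq> insert New_b (Old ` R)" using R(2) nc na by (intro S_sub) auto
        then show ?thesis using max_Tr(1)[OF R(1)] xR False by blast
      next
        case True
        \<comment> \<open>The set \<open>S\<close> is old, and one of \<open>a\<close> and \<open>c\<close> can always take the place of \<open>b\<close>.\<close>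
        then have "S \<subseteq> insert y (Old ` R)" for y
          using R(2) nc na x by (intro S_sub) auto
        then show ?thesis
          using max_Tr(2,3)[OF R(1)] xR True by (cases "v \<in> R") blast+
      qed
    next
      case a: True
      then have xa: "x \<noteq> New_a" and nb: "New_b \<notin> S" and vT: "v \<notin> T"
        using x S'(2,3) by blast+
      show ?thesis
      proof (cases "x = New_c")
        case True
        \<comment> \<open>Neither \<open>b\<close> nor \<open>c\<close> may be added, so the old part must avoid \<open>v\<close> instead of \<open>x\<close>.\<close>
        obtain R where R: "max_indep_set H R" "T \<subseteq> R" "R \<inter> {v} = {}"
          using ext[OF S'(1) indep_set_if_subset_singleton[OF H, of "{v}" v]] v vT by blast
        have "S \<subseteq> insert New_a (Old ` R)" using R(2) nc nb by (intro S_sub) auto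
        then show ?thesis using max_Tr(2)[OF R(1)] R(3) True by blast
      next
        case xc: False
        obtain R where R: "max_indep_set H R" "T \<subseteq> R" "R \<inter> X = {}"
          using ext[OF S'(1) X TX] by blast
        have xR: "x \<notin> Old ` R" using avoid[OF R(1,3)] by auto
        show ?thesis
        proof (cases "v \<in> R")
          case True
          have "S \<subseteq> insert New_a (insert New_c (Old ` (R - {v})))"
            using R(2) vT nb by (intro S_sub) auto
          then show ?thesis using max_Tr(4)[OF R(1) True] xR xc xa by blast
        next
          case False
          have "S \<subseteq> insert New_a (Old ` R)" using R(2) nc nb by (intro S_sub) auto
          then show ?thesis using max_Tr(2)[OF R(1) False] xR xa by blast
        qed
      qed
    qed
  qed
qed

theorem theorem3p5:
  fixes H :: "'a pair_pre_digraph" and v :: 'a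
  assumes "pair_graph H"
    and "v \<in> pverts H"
    and "nbrs H v \<noteq> {}"
  shows "W2_graph (Tr H v) \<longleftrightarrow> W2_graph H"
  using W2_graph_if_W2_graph_Tr[OF assms] W2_graph_Tr_if_W2_graph[OF assms(1,2)] by blast

end
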